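(* Let $n_{\mathcal G},k_{\mathcal G},n_{\mathcal H},k_{\mathcal H}$ be integers with $k_{\mathcal G}=n_{\mathcal G}\ge2$ and $k_{\mathcal H}=n_{\mathcal H}-2\ge2$. Put $$\alpha=(n_{\mathcal H}-2)\bigl(n_{\mathcal H}+\tfrac12(n_{\mathcal H}-1)\sqrt2\bigr),\quad \beta=-\bigl((2n_{\mathcal H}-3)+(n_{\mathcal H}-2)\sqrt2\bigr),\quad \gamma=2+\sqrt2.$$ Then the polynomials $$s_g=\alpha+\beta\Bigl(\sum_{h\in V(\mathcal H)}x_{gh}\Bigr)+\gamma\Bigl(\sum_{\{h,h'\}\subseteq V(\mathcal H)}x_{gh}x_{gh'}\Bigr)\qquad\text{for } g\in V(\mathcal G),$$ where the last sum runs over all 2-element subsets $\{h,h'\}$ of $V(\mathcal H)$, are a $2$-sos certificate of $f^{*}=\bigl(\sum_{g\in V(\mathcal G),h\in V(\mathcal H)}x_{gh}\bigr)-k_{\mathcal G}k_{\mathcal H}$, i.e. $$f^{*}\equiv\sum_{g\in V(\mathcal G)}s_g^2\mod I_{\mathrm{sos}}.$$ Consequently Vizing's conjecture holds for these parameters: $\gamma(G)\gamma(H)\le\gamma(G\Box H)$ for all graphs $G$ on $n_{\mathcal G}$ vertices with domination number $k_{\mathcal G}$ and all graphs $H$ on $n_{\mathcal H}$ vertices with domination number $k_{\mathcal H}$.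
   Context: Graphs are finite and simple. A set $D\subseteq V(G)$ is dominating in $G$ if every vertex of $V(G)\setminus D$ is adjacent to some vertex of $D$; the domination number $\gamma(G)$ is the minimum size of a dominating set (not to be confused with the scalar $\gamma$). The Cartesian product $G\Box H$ has vertex set $V(G)\times V(H)$, with $gh$ and $g'h'$ adjacent iff ($g=g'$ and $hh'\in E(H)$) or ($h=h'$ and $gg'\in E(G)$). Let $\mathbb K\subseteq\mathbb R$ be a field with $\sqrt2\in\mathbb K$. An $\ell$-sos certificate of $f$ modulo an ideal $I$ is a finite family of polynomials $s_i$ of degree at most $\ell$ with $f\equiv\sum_i s_i^2\bmod I$. Given positive integers $k_{\mathcal G}\le n_{\mathcal G}$ and $k_{\mathcal H}\le n_{\mathcal H}$, fix a set $V(\mathcal G)$ of $n_{\mathcal G}$ vertices with a fixed subset $D_{\mathcal G}$ of size $k_{\mathcal G}$, and a set $V(\mathcal H)$ of $n_{\mathcal H}$ vertices with a fixed subset $D_{\mathcal H}$ of size $k_{\mathcal H}$. Introduce variables $e_{gg'}=e_{g'g}$ for each 2-element subset $\{g,g'\}\subseteq V(\mathcal G)$, variables $e_{hh'}=e_{h'h}$ for each 2-element subset $\{h,h'\}\subseteq V(\mathcal H)$, and variables $x_{gh}$ for $g\in V(\mathcal G)$, $h\in V(\mathcal H)$ (all distinct). Let $P$ be the polynomial ring over $\mathbb K$ in all these variables. The ideal $I_{\mathrm{sos}}\subseteq P$ is generated by the following polynomials: - $e_{gg'}^2-e_{gg'}$ for $\{g,g'\}\subseteq V(\mathcal G)$;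 $\prod_{g'\in D_{\mathcal G}}(1-e_{gg'})$ for $g\in V(\mathcal G)\setminus D_{\mathcal G}$; $\prod_{g'\in V(\mathcal G)\setminus S}\bigl(\sum_{g\in S}e_{gg'}\bigr)$ for $S\subseteq V(\mathcal G)$ with $|S|=k_{\mathcal G}-1$; - the same three families with $\mathcal H$ in place of $\mathcal G$ (variables $e_{hh'}$, set $D_{\mathcal H}$, size $k_{\mathcal H}$); - $x_{gh}^2-x_{gh}$ and $(1-x_{gh})\prod_{g'\in V(\mathcal G),\,g'\ne g}(1-e_{gg'}x_{g'h})\prod_{h'\in V(\mathcal H),\,h'\neq h}(1-e_{hh'}x_{gh'})$ for $g\in V(\mathcal G)$, $h\in V(\mathcal H)$. *)

theory Defs
  imports
    Complex_Main
    "HOL-Library.Poly_Mapping"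
    "HOL-Algebra.Algebraic_Closure_Type"
    "Graph_Theory.Pair_Digraph"
begin

section \<open>Domination and Cartesian products of graphs\<close>

text \<open>
  A finite simple graph is a \<^locale>\<open>pair_graph\<close>: a finite set of vertices with a symmetric,
  loop-free set of arcs, the edge \<open>{u, v}\<close> being the pair of arcs \<open>(u, v)\<close> and \<open>(v, u)\<close>.
\<close>

definition dominating :: "'a pair_pre_digraph \<Rightarrow> 'a set \<Rightarrow> bool" where
  "dominating G D \<longleftrightarrow> D \<subseteq> pverts G \<and> (\<forall>v \<in> pverts G - D. \<exists>u \<in> D. (v, u) \<in> parcs G)"

definition domination_number :: "'a pair_pre_digraph \<Rightarrow> nat" where
  "domination_number G = Min (card ` {D. dominating G D})"

definition cartesian_product ::
    "'a pair_pre_digraph \<Rightarrow> 'b pair_pre_digraph \<Rightarrow> ('a \<times> 'b) pair_pre_digraph" (infixl "\<box>" 70) where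
  "G \<box> H = \<lparr> pverts = pverts G \<times> pverts H,
     parcs = {((g, h), (g', h')) | g h g' h'.
       (g = g' \<and> g \<in> pverts G \<and> (h, h') \<in> parcs H) \<or>
       (h = h' \<and> h \<in> pverts H \<and> (g, g') \<in> parcs G)} \<rparr>"


section \<open>Multivariate polynomials over a subfield of the reals\<close>

text \<open>
  A monomial maps each variable to its exponent and a polynomial maps each monomial to its
  coefficient; \<^theory>\<open>HOL-Library.Poly_Mapping\<close> equips this type with its ring structure.
\<close>

type_synonym 'v monom = "'v \<Rightarrow>\<^sub>0 nat"
type_synonym 'v real_mpoly = "'v monom \<Rightarrow>\<^sub>0 real"

definition Const :: "real \<Rightarrow> 'v real_mpoly" where
  "Const c = Poly_Mapping.single 0 c"

definition Var :: "'v \<Rightarrow> 'v real_mpoly" where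
  "Var v = Poly_Mapping.single (Poly_Mapping.single v 1) 1"

definition monom_degree :: "'v monom \<Rightarrow> nat" where
  "monom_degree m = (\<Sum>v \<in> Poly_Mapping.keys m. Poly_Mapping.lookup m v)"

text \<open>The zero polynomial has total degree 0 here, so it satisfies every degree bound.\<close>

definition total_degree :: "'v real_mpoly \<Rightarrow> nat" where
  "total_degree p = Max (insert 0 (monom_degree ` Poly_Mapping.keys p))"

text \<open>The polynomial ring \<open>K[V]\<close> over \<open>K \<subseteq> \<real>\<close> in the set of variables \<open>V\<close>, as a ring in the
  sense of \<open>HOL-Algebra\<close>.\<close>

definition mpoly_ring :: "real set \<Rightarrow> 'v set \<Rightarrow> 'v real_mpoly ring" where
  "mpoly_ring K V = ring_of_type_algebra
     \<lparr> carrier := {p. (\<forall>m. Poly_Mapping.lookup p m \<in> K) \<and>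
                      (\<forall>m \<in> Poly_Mapping.keys p. Poly_Mapping.keys m \<subseteq> V)} \<rparr>"

text \<open>
  The family \<open>(s i)\<close>, \<open>i \<in> A\<close>, is a \<open>d\<close>-sos certificate of \<open>f\<close> modulo the ideal \<open>I\<close> of \<open>K[V]\<close>.
\<close>

definition sos_certificate ::
    "real set \<Rightarrow> 'v set \<Rightarrow> 'v real_mpoly set \<Rightarrow> nat \<Rightarrow> 'i set \<Rightarrow> ('i \<Rightarrow> 'v real_mpoly) \<Rightarrow>
     'v real_mpoly \<Rightarrow> bool" where
  "sos_certificate K V I d A s f \<longleftrightarrow>
     finite A \<and>
     (\<forall>i \<in> A. s i \<in> carrier (mpoly_ring K V) \<and> total_degree (s i) \<le> d) \<and>
     f - (\<Sum>i \<in> A. (s i)\<^sup>2) \<in> I"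


section \<open>The Vizing ideal\<close>

definition pairs :: "'a set \<Rightarrow> 'a set set" where
  "pairs V = {S. S \<subseteq> V \<and> card S = 2}"

text \<open>Edge variables are indexed by 2-element sets, so that \<open>e\<^bsub>gg'\<^esub> = e\<^bsub>g'g\<^esub>\<close>.\<close>

datatype ('g, 'h) vizing_var = EG "'g set" | EH "'h set" | XV 'g 'h

definition vizing_vars :: "'g set \<Rightarrow> 'h set \<Rightarrow> ('g, 'h) vizing_var set" where
  "vizing_vars VG VH = EG ` pairs VG \<union> EH ` pairs VH \<union> {XV g h | g h. g \<in> VG \<and> h \<in> VH}"

text \<open>
  The three families of generators for one factor, with edge variables \<open>E {u, v}\<close>; their common
  zeros are the graphs on \<open>V\<close> in which \<open>D\<close> is dominating and no set of size \<open>k - 1\<close> is.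
\<close>

definition graph_gens :: "('a set \<Rightarrow> 'v) \<Rightarrow> 'a set \<Rightarrow> 'a set \<Rightarrow> nat \<Rightarrow> 'v real_mpoly set" where
  "graph_gens E V D k =
     {(Var (E S))\<^sup>2 - Var (E S) | S. S \<in> pairs V} \<union>
     {\<Prod>v' \<in> D. (1 - Var (E {v, v'})) | v. v \<in> V - D} \<union>
     {\<Prod>v' \<in> V - S. \<Sum>v \<in> S. Var (E {v, v'}) | S. S \<subseteq> V \<and> card S = k - 1}"

definition product_gens :: "'g set \<Rightarrow> 'h set \<Rightarrow> ('g, 'h) vizing_var real_mpoly set" where
  "product_gens VG VH =
     {(Var (XV g h))\<^sup>2 - Var (XV g h) | g h. g \<in> VG \<and> h \<in> VH} \<union>
     {(1 - Var (XV g h)) *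
        (\<Prod>g' \<in> VG - {g}. (1 - Var (EG {g, g'}) * Var (XV g' h))) *
        (\<Prod>h' \<in> VH - {h}. (1 - Var (EH {h, h'}) * Var (XV g h')))
      | g h. g \<in> VG \<and> h \<in> VH}"

definition I_sos ::
    "real set \<Rightarrow> 'g set \<Rightarrow> 'g set \<Rightarrow> nat \<Rightarrow> 'h set \<Rightarrow> 'h set \<Rightarrow> nat \<Rightarrow>
     ('g, 'h) vizing_var real_mpoly set" where
  "I_sos K VG DG kG VH DH kH =
     genideal (mpoly_ring K (vizing_vars VG VH))
       (graph_gens EG VG DG kG \<union> graph_gens EH VH DH kH \<union> product_gens VG VH)"

definition f_star :: "'g set \<Rightarrow> nat \<Rightarrow> 'h set \<Rightarrow> nat \<Rightarrow> ('g, 'h) vizing_var real_mpoly" where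
  "f_star VG kG VH kH =
     (\<Sum>g \<in> VG. \<Sum>h \<in> VH. Var (XV g h)) - Const (real kG * real kH)"

end

theory Submission
  imports Defs
begin

text \<open>
  Modulo the polynomials \<open>x\<^sup>2 - x\<close> the ring is spanned by the products \<open>\<delta>\<^sub>A\<close> that represent the
  indicator functions of the 0/1 points \<open>A\<close>, and \<open>p \<delta>\<^sub>A = p(A) \<delta>\<^sub>A\<close>. Hence a polynomial that vanishes at
  all common 0/1 zeros of the generators lies in the ideal. At such a zero the graph \<open>G\<close>
  has no edges, so in each fibre the chosen vertices dominate \<open>H\<close>, and their number \<open>m\<close> is \<open>n - 2\<close>,
  \<open>n - 1\<close> or \<open>n\<close>, where \<open>n\<close> is the order of \<open>H\<close>. The coefficients interpolate
  \<open>s(m) = 0, -1, \<surd>2\<close>, so that \<open>s(m)\<^sup>2 = m - (n - 2)\<close>.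
\<close>

section \<open>Polynomials over a subfield of the reals\<close>

lemma Const_simps:
  "Const 0 = 0" "Const 1 = 1"
  "Const (a + b) = Const a + Const b" "Const (a - b) = Const a - Const b"
  "Const (a * b) = Const a * Const b"
  by (simp_all add: Const_def single_add single_diff mult_single)

section \<open>Closure properties of the subfield\<close>

locale real_subfield =
  fixes K :: "real set"
  assumes subfield: "subfield K ring_of_type_algebra"
begin

interpretation R: cring "ring_of_type_algebra :: real ring"
  by (rule cring_from_type_algebra)

lemma one_mem: "1 \<in> K"
  and add_mem: "\<lbrakk>a \<in> K; b \<in> K\<rbrakk> \<Longrightarrow> a + b \<in> K"
  and mult_mem: "\<lbrakk>a \<in> K; b \<in> K\<rbrakk> \<Longrightarrow> a * b \<in> K"
proof -
  have sub: "subring K ring_of_type_algebra"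
    using subfield by (intro subcring.axioms subdomain.axioms subfield.axioms)
  show "1 \<in> K"
    using submonoid.one_closed[OF subring.axioms(2)[OF sub]]
    by (simp add: ring_of_type_algebra_def)
  show "\<lbrakk>a \<in> K; b \<in> K\<rbrakk> \<Longrightarrow> a + b \<in> K"
    using subgroup.m_closed[OF subring.axioms(1)[OF sub]]
    by (simp add: ring_of_type_algebra_def)
  show "\<lbrakk>a \<in> K; b \<in> K\<rbrakk> \<Longrightarrow> a * b \<in> K"
    using submonoid.m_closed[OF subring.axioms(2)[OF sub]]
    by (simp add: ring_of_type_algebra_def)
qed

lemma uminus_mem: "a \<in> K \<Longrightarrow> - a \<in> K"
proof -
  assume a: "a \<in> K"
  interpret subfield K "ring_of_type_algebra :: real ring" by (rule subfield)
  have "a_inv (ring_of_type_algebra :: real ring) a \<in> K"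
    using m_inv_closed[OF a] by (simp add: a_inv_def)
  \<comment> \<open>\<open>a_inv\<close> is given by a description; uniqueness of additive inverses
    identifies it with the real negation.\<close>
  moreover have "a_inv (ring_of_type_algebra :: real ring) a = - a"
    by (rule R.minus_equality) (simp_all add: ring_of_type_algebra_def)
  ultimately show ?thesis
    by simp
qed

lemma zero_mem: "0 \<in> K"
  using add_mem[OF one_mem uminus_mem[OF one_mem]] by simp

lemma diff_mem: "\<lbrakk>a \<in> K; b \<in> K\<rbrakk> \<Longrightarrow> a - b \<in> K"
  using add_mem[OF _ uminus_mem, of a b] by simp

lemma sum_mem: "(\<And>a. a \<in> A \<Longrightarrow> f a \<in> K) \<Longrightarrow> sum f A \<in> K"
  by (induction A rule: infinite_finite_induct) (auto intro: zero_mem add_mem)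

lemma of_nat_mem: "of_nat n \<in> K"
  by (induction n) (auto intro: zero_mem add_mem one_mem)

lemma inverse_mem:
  assumes "a \<in> K"
  shows "inverse a \<in> K"
\<comment> \<open>Real inversion is total with \<open>inverse 0 = 0\<close>, so zero forms a case of
  its own. A nonzero element is a unit of the ring restricted to \<open>K\<close>, which provides an
  inverse inside \<open>K\<close>.\<close>
proof (cases "a = 0")
  case False
  have "a \<in> Units ((ring_of_type_algebra :: real ring)\<lparr>carrier := K\<rparr>)"
    using subfield.subfield_Units[OF subfield] assms False
    by (simp add: ring_of_type_algebra_def)
  then obtain b where "b \<in> K" "a * b = 1"
    unfolding Units_def by (auto simp: ring_of_type_algebra_def)
  then show ?thesis
    by (metis inverse_unique)
qed (simp add: zero_mem)

lemma divide_mem: "\<lbrakk>a \<in> K; b \<in> K\<rbrakk> \<Longrightarrow> a / b \<in> K"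
  by (simp add: divide_inverse inverse_mem mult_mem)

section \<open>Closure properties of the polynomial ring\<close>

abbreviation poly_carrier :: "'v set \<Rightarrow> 'v real_mpoly set" where
  "poly_carrier V \<equiv> carrier (mpoly_ring K V)"

lemma poly_carrier_iff:
  "p \<in> poly_carrier V \<longleftrightarrow> (\<forall>m. Poly_Mapping.lookup p m \<in> K) \<and>
     (\<forall>m \<in> Poly_Mapping.keys p. Poly_Mapping.keys m \<subseteq> V)"
  by (simp add: mpoly_ring_def)

lemma Const_mem: "c \<in> K \<Longrightarrow> Const c \<in> poly_carrier V"
  by (auto simp: poly_carrier_iff Const_def lookup_single zero_mem when_def split: if_splits)

lemma Var_mem: "v \<in> V \<Longrightarrow> Var v \<in> poly_carrier V"
  by (auto simp: poly_carrier_iff Var_def lookup_single zero_mem one_mem when_def split: if_splits)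

lemma poly_add_mem: "\<lbrakk>p \<in> poly_carrier V; q \<in> poly_carrier V\<rbrakk> \<Longrightarrow> p + q \<in> poly_carrier V"
  unfolding poly_carrier_iff using keys_add[of p q] by (simp add: lookup_add add_mem) blast

lemma poly_uminus_mem: "p \<in> poly_carrier V \<Longrightarrow> - p \<in> poly_carrier V"
  unfolding poly_carrier_iff by (auto simp: uminus_mem)

lemma poly_diff_mem: "\<lbrakk>p \<in> poly_carrier V; q \<in> poly_carrier V\<rbrakk> \<Longrightarrow> p - q \<in> poly_carrier V"
  using poly_add_mem[OF _ poly_uminus_mem, of p V q] by simp

lemma poly_mult_mem:
  assumes "p \<in> poly_carrier V" "q \<in> poly_carrier V"
  shows "p * q \<in> poly_carrier V"
  unfolding poly_carrier_iff
proof (intro conjI allI ballI)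
  fix m
  show "Poly_Mapping.lookup (p * q) m \<in> K"
    \<comment> \<open>The convolution turns into ordinary sums over supports; \<open>sum_mem\<close>
      asks for no finiteness, because a sum over an infinite set is 0.\<close>
    unfolding lookup_mult Sum_any.expand_set using assms
    by (intro sum_mem mult_mem) (auto simp: when_def poly_carrier_iff intro: zero_mem)
next
  fix m assume "m \<in> Poly_Mapping.keys (p * q)"
  then obtain a b where "a \<in> Poly_Mapping.keys p" "b \<in> Poly_Mapping.keys q" "m = a + b"
    using keys_mult[of p q] by auto
  then show "Poly_Mapping.keys m \<subseteq> V"
    using assms keys_add[of a b] by (force simp: poly_carrier_iff)
qed

lemma poly_sum_mem: "(\<And>a. a \<in> A \<Longrightarrow> f a \<in> poly_carrier V) \<Longrightarrow> sum f A \<in> poly_carrier V"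
  using Const_mem[OF zero_mem, of V]
  by (induction A rule: infinite_finite_induct) (auto simp: Const_simps intro: poly_add_mem)

lemma poly_prod_mem: "(\<And>a. a \<in> A \<Longrightarrow> f a \<in> poly_carrier V) \<Longrightarrow> prod f A \<in> poly_carrier V"
  using Const_mem[OF one_mem, of V]
  by (induction A rule: infinite_finite_induct) (auto simp: Const_simps intro: poly_mult_mem)

end

section \<open>Degree bounds, checked monomial by monomial\<close>

definition deg_le :: "nat \<Rightarrow> 'v real_mpoly \<Rightarrow> bool" where
  "deg_le d p \<longleftrightarrow> (\<forall>m \<in> Poly_Mapping.keys p. monom_degree m \<le> d)"

lemma total_degree_le_iff: "total_degree p \<le> d \<longleftrightarrow> deg_le d p"
  by (simp add: total_degree_def deg_le_def)

lemma monom_degree_add: "monom_degree (a + b) = monom_degree a + monom_degree b"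
  unfolding monom_degree_def
  by (rule setsum_keys_plus_distrib) simp_all

lemma deg_le_Const: "deg_le d (Const c)"
  by (simp add: deg_le_def Const_def monom_degree_def)

lemma deg_le_Var: "deg_le 1 (Var v)"
  by (simp add: deg_le_def Var_def monom_degree_def)

lemma deg_le_mono: "\<lbrakk>deg_le d p; d \<le> e\<rbrakk> \<Longrightarrow> deg_le e p"
  by (force simp: deg_le_def)

lemma deg_le_add: "\<lbrakk>deg_le d p; deg_le d q\<rbrakk> \<Longrightarrow> deg_le d (p + q)"
  using keys_add[of p q] by (auto simp: deg_le_def)

lemma deg_le_mult: "\<lbrakk>deg_le d p; deg_le e q\<rbrakk> \<Longrightarrow> deg_le (d + e) (p * q)"
  using keys_mult[of p q] by (force simp: deg_le_def monom_degree_add intro: add_mono)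

lemma deg_le_sum: "(\<And>a. a \<in> A \<Longrightarrow> deg_le d (f a)) \<Longrightarrow> deg_le d (sum f A)"
proof (induction A rule: infinite_finite_induct)
  case (insert x A)
  then show ?case by (simp add: deg_le_add)
qed (simp_all add: deg_le_def)

lemma deg_le_prod: "(\<And>a. a \<in> A \<Longrightarrow> deg_le 1 (f a)) \<Longrightarrow> deg_le (card A) (prod f A)"
proof (induction A rule: infinite_finite_induct)
  case (insert x A)
  then show ?case using deg_le_mult[of 1 "f x" "card A" "prod f A"] by simp
\<comment> \<open>An infinite index set has cardinality 0 and product 1, which agrees with the
  bound.\<close>
qed (simp_all add: deg_le_def monom_degree_def)


section \<open>A Nullstellensatz over 0/1 points\<close>

locale boolean_ideal = real_subfield K for K +
  fixes V :: "'v set" and I :: "'v real_mpoly set"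
  assumes finite_vars: "finite V"
    and is_ideal: "ideal I (mpoly_ring K V)"
    and boolean: "v \<in> V \<Longrightarrow> (Var v)\<^sup>2 - Var v \<in> I"
begin

interpretation ideal I "mpoly_ring K V" by (rule is_ideal)

lemma I_zero: "0 \<in> I"
  using additive_subgroup.zero_closed[OF is_additive_subgroup]
  by (simp add: mpoly_ring_def ring_of_type_algebra_def)

lemma I_add: "\<lbrakk>p \<in> I; q \<in> I\<rbrakk> \<Longrightarrow> p + q \<in> I"
  using additive_subgroup.a_closed[OF is_additive_subgroup]
  by (simp add: mpoly_ring_def ring_of_type_algebra_def)

lemma I_mult: "\<lbrakk>p \<in> I; q \<in> poly_carrier V\<rbrakk> \<Longrightarrow> q * p \<in> I"
  using I_l_closed by (simp add: mpoly_ring_def ring_of_type_algebra_def)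

lemma I_mult': "\<lbrakk>p \<in> I; q \<in> poly_carrier V\<rbrakk> \<Longrightarrow> p * q \<in> I"
  using I_mult by (simp add: mult.commute)

lemma I_uminus: "p \<in> I \<Longrightarrow> - p \<in> I"
  using I_mult[of p "- 1"] poly_uminus_mem[OF Const_mem[OF one_mem], of V]
  by (simp add: Const_simps)

lemma I_diff: "\<lbrakk>p \<in> I; q \<in> I\<rbrakk> \<Longrightarrow> p - q \<in> I"
  using I_add[OF _ I_uminus, of p q] by simp

lemma I_sum: "(\<And>a. a \<in> A \<Longrightarrow> f a \<in> I) \<Longrightarrow> sum f A \<in> I"
  by (induction A rule: infinite_finite_induct) (auto intro: I_zero I_add)

lemma one_minus_Var_mem: "v \<in> V \<Longrightarrow> 1 - Var v \<in> poly_carrier V"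
  using poly_diff_mem[OF Const_mem[OF one_mem] Var_mem] by (simp add: Const_simps)

text \<open>A 0/1 point is encoded as the set of variables that are 1 there. This is the indicator
  polynomial, of value 1 at \<open>A\<close> and 0 at every other 0/1 point.\<close>

definition ind :: "'v set \<Rightarrow> 'v real_mpoly" where
  "ind A = (\<Prod>v \<in> A. Var v) * (\<Prod>v \<in> V - A. 1 - Var v)"

lemma ind_mem: "A \<subseteq> V \<Longrightarrow> ind A \<in> poly_carrier V"
  unfolding ind_def by (intro poly_mult_mem poly_prod_mem) (auto intro: Var_mem one_minus_Var_mem)

text \<open>Expand the product of the factors \<open>Var v + (1 - Var v)\<close>, each of which is
  1; choosing a summand in every factor amounts to choosing a subset of \<open>V\<close>.\<close>

lemma sum_ind: "(\<Sum>A \<in> Pow V. ind A) = 1"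
  using prod_add[OF finite_vars, of Var "\<lambda>v. 1 - Var v"] by (simp add: ind_def)

text \<open>\<open>val A p c\<close> expresses that \<open>p\<close> takes the value \<open>c\<close> at the point \<open>A\<close>, as far as \<open>I\<close> can tell: if
  the indicator of \<open>A\<close> lies in \<open>I\<close>, every \<open>c\<close> qualifies.\<close>

definition val :: "'v set \<Rightarrow> 'v real_mpoly \<Rightarrow> real \<Rightarrow> bool" where
  "val A p c \<longleftrightarrow> p \<in> poly_carrier V \<and> c \<in> K \<and> (p - Const c) * ind A \<in> I"

context
  fixes A assumes A: "A \<subseteq> V"
begin

lemma val_Const: "c \<in> K \<Longrightarrow> val A (Const c) c"
  by (simp add: val_def Const_mem I_zero)

lemma val_1: "val A 1 1"
  using val_Const[OF one_mem] by (simp add: Const_simps)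

lemma val_0: "val A 0 0"
  using val_Const[OF zero_mem] by (simp add: Const_simps)

lemma val_add: "\<lbrakk>val A p a; val A q b\<rbrakk> \<Longrightarrow> val A (p + q) (a + b)"
  using I_add[of "(p - Const a) * ind A" "(q - Const b) * ind A"]
  by (auto simp: val_def poly_add_mem add_mem Const_simps algebra_simps)

lemma val_diff: "\<lbrakk>val A p a; val A q b\<rbrakk> \<Longrightarrow> val A (p - q) (a - b)"
  using I_diff[of "(p - Const a) * ind A" "(q - Const b) * ind A"]
  by (auto simp: val_def poly_diff_mem diff_mem Const_simps algebra_simps)

lemma val_mult:
  assumes "val A p a" "val A q b"
  shows "val A (p * q) (a * b)"
proof -
  \<comment> \<open>The splitting pq - ab = (p - a)q + a(q - b), multiplied by the
    indicator.\<close>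
  have "(p - Const a) * ind A * q + Const a * ((q - Const b) * ind A) \<in> I"
    using assms
    by (intro I_add[OF I_mult'[OF _ _] I_mult[OF _ Const_mem]]) (auto simp: val_def)
  moreover have "(p - Const a) * ind A * q + Const a * ((q - Const b) * ind A)
      = (p * q - Const (a * b)) * ind A"
    by (simp add: Const_simps algebra_simps)
  ultimately show ?thesis
    using assms by (auto simp: val_def poly_mult_mem mult_mem)
qed

lemma val_sum: "(\<And>i. i \<in> J \<Longrightarrow> val A (f i) (g i)) \<Longrightarrow> val A (sum f J) (sum g J)"
  by (induction J rule: infinite_finite_induct) (auto intro: val_0 val_add)

lemma val_prod: "(\<And>i. i \<in> J \<Longrightarrow> val A (f i) (g i)) \<Longrightarrow> val A (prod f J) (prod g J)"
  by (induction J rule: infinite_finite_induct) (auto intro: val_1 val_mult)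

lemma val_power2: "val A p a \<Longrightarrow> val A (p\<^sup>2) (a\<^sup>2)"
  by (simp add: power2_eq_square val_mult)

text \<open>The indicator has \<open>Var v\<close> or \<open>1 - Var v\<close> as a factor, so
  multiplying it by \<open>Var v\<close> minus its value gives a multiple of
  \<open>(Var v)\<^sup>2 - Var v\<close>.\<close>

lemma val_Var:
  assumes v: "v \<in> V"
  shows "val A (Var v) (of_bool (v \<in> A))"
proof (cases "v \<in> A")
  case True
  define r where "r = (\<Prod>w \<in> A - {v}. Var w) * (\<Prod>w \<in> V - A. 1 - Var w)"
  have ind: "ind A = Var v * r"
    unfolding ind_def r_def using True finite_subset[OF A finite_vars]
    by (simp add: prod.remove mult.assoc)
  have "(Var v - Const 1) * ind A = ((Var v)\<^sup>2 - Var v) * r"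
    by (simp add: ind Const_simps algebra_simps power2_eq_square)
  moreover have "r \<in> poly_carrier V"
    unfolding r_def using A
    by (intro poly_mult_mem poly_prod_mem) (auto intro: Var_mem one_minus_Var_mem)
  ultimately show ?thesis
    using True v boolean by (auto simp: val_def Var_mem one_mem I_mult')
next
  case False
  define r where "r = (\<Prod>w \<in> A. Var w) * (\<Prod>w \<in> V - A - {v}. 1 - Var w)"
  have ind: "ind A = (1 - Var v) * r"
    unfolding ind_def r_def using False v finite_vars
    by (simp add: prod.remove mult_ac)
  have "(Var v - Const 0) * ind A = ((Var v)\<^sup>2 - Var v) * (- r)"
    by (simp add: ind Const_simps algebra_simps power2_eq_square)
  moreover have "- r \<in> poly_carrier V"
    unfolding r_def using A
    by (intro poly_uminus_mem poly_mult_mem poly_prod_mem) (auto intro: Var_mem one_minus_Var_mem)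
  moreover have "((Var v)\<^sup>2 - Var v) * (- r) \<in> I"
    using calculation v by (intro I_mult' boolean)
  ultimately show ?thesis
    using False v by (simp add: val_def Var_mem zero_mem)
qed

text \<open>Subtracting the two multiples of the indicator leaves c times the indicator in
  \<open>I\<close>, and c is invertible in the field \<open>K\<close>.\<close>

lemma ind_mem_I:
  assumes "q \<in> I" "val A q c" "c \<noteq> 0"
  shows "ind A \<in> I"
proof -
  have "q * ind A - (q - Const c) * ind A \<in> I"
    using assms by (intro I_diff[OF I_mult'[OF _ ind_mem[OF A]]]) (auto simp: val_def)
  then have mem: "Const c * ind A \<in> I"
    by (simp add: algebra_simps)
  then have "Const (inverse c) * (Const c * ind A) \<in> I"
    using assms(2) by (intro I_mult[OF mem] Const_mem inverse_mem) (auto simp: val_def)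
  moreover have "Const (inverse c) * (Const c * ind A) = Const (inverse c * c) * ind A"
    by (simp only: Const_simps mult.assoc)
  ultimately show ?thesis
    using assms(3) by (simp add: Const_simps(2))
qed

end

text \<open>Since the indicators sum to 1, it suffices to treat each \<open>p * ind A\<close>. If
  some member of \<open>I\<close> has a nonzero value at \<open>A\<close>, the indicator itself lies
  in \<open>I\<close>; otherwise \<open>A\<close> is a common zero of \<open>I\<close> and the
  hypothesis on \<open>p\<close> applies.\<close>

theorem mem_if_vanishes_on_zeros:
  assumes "p \<in> poly_carrier V"
    and zero: "\<And>A. \<lbrakk>A \<subseteq> V; \<And>q c. \<lbrakk>q \<in> I; val A q c\<rbrakk> \<Longrightarrow> c = 0\<rbrakk> \<Longrightarrow> val A p 0"
  shows "p \<in> I"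
proof -
  have "p * ind A \<in> I" if A: "A \<subseteq> V" for A
  proof (cases "\<exists>q c. q \<in> I \<and> val A q c \<and> c \<noteq> 0")
    case True
    then show ?thesis
      using ind_mem_I[OF A] I_mult assms(1) by blast
  next
    case False
    then have "val A p 0" using zero[OF A] by blast
    then show ?thesis by (simp add: val_def Const_simps)
  qed
  then have "(\<Sum>A \<in> Pow V. p * ind A) \<in> I"
    by (intro I_sum) auto
  then show ?thesis
    by (simp add: sum_ind flip: sum_distrib_left)
qed

end


section \<open>The certificate\<close>

definition sos_poly :: "real \<Rightarrow> real \<Rightarrow> real \<Rightarrow> 'h set \<Rightarrow> 'g \<Rightarrow> ('g, 'h) vizing_var real_mpoly" where
  "sos_poly \<alpha> \<beta> \<gamma> VH g = Const \<alpha> + Const \<beta> * (\<Sum>h \<in> VH. Var (XV g h))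
     + Const \<gamma> * (\<Sum>S \<in> pairs VH. \<Prod>h \<in> S. Var (XV g h))"

lemma deg_le_sos_poly: "deg_le 2 (sos_poly \<alpha> \<beta> \<gamma> VH g)"
proof -
  \<comment> \<open>The bound is written \<open>0 + 1\<close> to match the sum of degrees in
    \<open>deg_le_mult\<close>.\<close>
  have linear: "deg_le (0 + 1) (Const \<beta> * (\<Sum>h \<in> VH. Var (XV g h)))"
    by (intro deg_le_mult deg_le_sum deg_le_Const deg_le_Var)
  moreover have "deg_le (0 + 2) (Const \<gamma> * (\<Sum>S \<in> pairs VH. \<Prod>h \<in> S. Var (XV g h)))"
  proof (intro deg_le_mult deg_le_sum deg_le_Const)
    fix S assume "S \<in> pairs VH"
    then show "deg_le 2 (\<Prod>h \<in> S. Var (XV g h))"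
      using deg_le_prod[of S "\<lambda>h. Var (XV g h)", OF deg_le_Var] by (auto simp: pairs_def)
  qed
  ultimately show ?thesis
    unfolding sos_poly_def by (intro deg_le_add deg_le_Const deg_le_mono[OF linear])
      (simp_all add: numeral_2_eq_2)
qed

section \<open>Values of the symmetric sums and of the certificate at 0/1 points\<close>

lemma real_choose_two: "real (m choose 2) = real m * (real m - 1) / 2"
  by (induction m) (auto simp: numeral_2_eq_2 field_simps)

lemma sum_of_bool_mem:
  assumes "finite V" "B \<subseteq> V"
  shows "(\<Sum>h \<in> V. of_bool (h \<in> B)) = real (card B)"
  using assms by (simp add: sum.If_cases of_bool_def Int_absorb1 Collect_conj_eq)

text \<open>A product of indicators over \<open>S\<close> is 1 exactly when \<open>S\<close> lies
  inside \<open>B\<close>, so the sum counts the 2-element subsets of \<open>B\<close>.\<close>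

lemma sum_pairs_of_bool_mem:
  assumes "finite V" "B \<subseteq> V"
  shows "(\<Sum>S \<in> pairs V. \<Prod>h \<in> S. of_bool (h \<in> B)) = real (card B choose 2)"
proof -
  have fin: "finite (pairs V)"
    using assms(1) by (simp add: pairs_def)
  have "(\<Prod>h \<in> S. of_bool (h \<in> B) :: real) = of_bool (S \<in> pairs B)" if S: "S \<in> pairs V" for S
  proof (cases "S \<subseteq> B")
    case True
    then show ?thesis using S by (auto simp: pairs_def intro!: prod.neutral)
  next
    case False
    moreover have "finite S"
      using S assms(1) by (auto simp: pairs_def dest: finite_subset)
    ultimately show ?thesis by (auto simp: pairs_def)
  qed
  then have "(\<Sum>S \<in> pairs V. \<Prod>h \<in> S. of_bool (h \<in> B) :: real)
      = (\<Sum>S \<in> pairs V. of_bool (S \<in> pairs B))"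
    by (rule sum.cong[OF refl])
  also have "\<dots> = real (card (pairs B))"
    using assms by (intro sum_of_bool_mem fin) (auto simp: pairs_def)
  also have "card (pairs B) = card B choose 2"
    unfolding pairs_def using assms by (intro n_subsets) (rule finite_subset)
  finally show ?thesis .
qed

text \<open>The value of \<open>sos_poly\<close> in a fibre with m chosen vertices out of n. The
  coefficients are spelled out in the form of the theorem so that they fold back into \<alpha>,
  \<beta> and \<gamma>.\<close>

definition interpolant :: "nat \<Rightarrow> nat \<Rightarrow> real" where
  "interpolant n m = (real n - 2) * (real n + 1 / 2 * (real n - 1) * sqrt 2)
     + - ((2 * real n - 3) + (real n - 2) * sqrt 2) * real m + (2 + sqrt 2) * real (m choose 2)"

lemma interpolant_power2:
  assumes "n - 2 \<le> m" "m \<le> n" "2 \<le> n"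
  shows "(interpolant n m)\<^sup>2 = real m - real (n - 2)"
proof -
  \<comment> \<open>With sqrt 2 abstracted to \<open>t\<close>, the three evaluations are identities
    of rational expressions in \<open>r\<close> and \<open>t\<close>; \<open>t2\<close> enters when
    the value \<open>t\<close> is squared.\<close>
  define r t where "r = real n" and "t = sqrt 2"
  have t2: "t\<^sup>2 = 2"
    by (simp add: t_def)
  have n2: "real (n - 2) = r - 2"
    using assms(3) by (simp add: r_def of_nat_diff)
  have "m = n - 2 \<or> m = n - 1 \<or> m = n"
    using assms by arith
  then consider "real m = r - 2" | "real m = r - 1" | "real m = r"
    using assms(3) unfolding r_def by (elim disjE) (simp_all add: of_nat_diff)
  then show ?thesis
  proof cases
    case 1
    have "interpolant n m = 0"
      unfolding interpolant_def real_choose_two 1 r_def [symmetric] t_def [symmetric]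
      by (simp add: field_simps)
    then show ?thesis by (simp add: 1 n2)
  next
    case 2
    have "interpolant n m = - 1"
      unfolding interpolant_def real_choose_two 2 r_def [symmetric] t_def [symmetric]
      by (simp add: field_simps)
    then show ?thesis by (simp add: 2 n2)
  next
    case 3
    have "interpolant n m = t"
      unfolding interpolant_def real_choose_two 3 r_def [symmetric] t_def [symmetric]
      by (simp add: field_simps)
    then show ?thesis by (simp add: 3 n2 t2)
  qed
qed

section \<open>From vanishing generators to domination\<close>

lemma prod_eq_0_obtains:
  assumes "prod f J = (0 :: real)"
  obtains i where "i \<in> J" "f i = 0"
proof -
  have "finite J"
    \<comment> \<open>A product over an infinite set would be 1.\<close>
    using assms by (rule contrapos_pp) simp
  then show ?thesis
    using assms that prod_zero_iff[of J f] by blast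
qed

text \<open>A smaller \<open>B\<close> could be enlarged to a set \<open>S\<close> of size k - 1.
  The vertex that \<open>S\<close> leaves undominated lies outside \<open>B\<close>, yet
  \<open>B\<close> dominates it.\<close>

lemma card_fibre_ge:
  fixes V :: "'a set"
  assumes fin: "finite V" and k: "k \<le> card V" and B: "B \<subseteq> V"
    and nondom: "\<And>S. \<lbrakk>S \<subseteq> V; card S = k - 1\<rbrakk> \<Longrightarrow> \<exists>w \<in> V - S. \<forall>v \<in> S. {v, w} \<notin> E"
    and dom: "\<And>h. h \<in> V - B \<Longrightarrow> \<exists>h' \<in> B. {h, h'} \<in> E"
  shows "k \<le> card B"
proof (rule ccontr)
  assume "\<not> k \<le> card B"
  then have "card B \<le> k - 1" "k - 1 \<le> card V"
    using k by linarith+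
  then obtain S where S: "B \<subseteq> S" "S \<subseteq> V" "card S = k - 1"
    using exists_subset_between[of B "k - 1" V] B fin by metis
  then obtain w where w: "w \<in> V - S" "\<forall>v \<in> S. {v, w} \<notin> E"
    using nondom by blast
  then obtain h' where "h' \<in> B" "{w, h'} \<in> E"
    using dom[of w] S by blast
  then show False
    using w S by (auto simp: insert_commute)
qed

lemma finite_vizing_vars: "\<lbrakk>finite VG; finite VH\<rbrakk> \<Longrightarrow> finite (vizing_vars VG VH)"
proof -
  assume "finite VG" "finite VH"
  moreover have "{XV g h | g h. g \<in> VG \<and> h \<in> VH} = (\<lambda>(g, h). XV g h) ` (VG \<times> VH)"
    by auto
  ultimately show ?thesis
    by (simp add: vizing_vars_def pairs_def)
qed

lemma vizing_vars_mem:
  "\<lbrakk>g \<in> VG; g' \<in> VG; g \<noteq> g'\<rbrakk> \<Longrightarrow> EG {g, g'} \<in> vizing_vars VG VH"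
  "\<lbrakk>h \<in> VH; h' \<in> VH; h \<noteq> h'\<rbrakk> \<Longrightarrow> EH {h, h'} \<in> vizing_vars VG VH"
  "\<lbrakk>g \<in> VG; h \<in> VH\<rbrakk> \<Longrightarrow> XV g h \<in> vizing_vars VG VH"
  by (auto simp: vizing_vars_def pairs_def card_insert_if intro!: imageI)

section \<open>Membership of the certificate in the ideal\<close>

context real_subfield
begin

lemma sos_certificate_vizing:
  fixes VG :: "'g set" and VH :: "'h set"
  assumes sqrt: "sqrt 2 \<in> K"
    and VG: "finite VG" "card VG = nG"
    and VH: "finite VH" "card VH = nH" "nH \<ge> 2"
    and \<alpha>: "\<alpha> = (real nH - 2) * (real nH + 1 / 2 * (real nH - 1) * sqrt 2)"
    and \<beta>: "\<beta> = - ((2 * real nH - 3) + (real nH - 2) * sqrt 2)"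
    and \<gamma>: "\<gamma> = 2 + sqrt 2"
  shows "sos_certificate K (vizing_vars VG VH) (I_sos K VG DG nG VH DH (nH - 2)) 2 VG
    (sos_poly \<alpha> \<beta> \<gamma> VH) (f_star VG nG VH (nH - 2))"
proof -
  let ?V = "vizing_vars VG VH" and ?s = "sos_poly \<alpha> \<beta> \<gamma> VH"
  let ?f = "f_star VG nG VH (nH - 2)"
  let ?gens = "graph_gens EG VG DG nG \<union> graph_gens EH VH DH (nH - 2) \<union> product_gens VG VH"
  have numeral_mem: "numeral m \<in> K" for m
    using of_nat_mem[of "numeral m"] by simp
  have coeffs: "\<alpha> \<in> K" "\<beta> \<in> K" "\<gamma> \<in> K"
    unfolding \<alpha> \<beta> \<gamma>
    by (intro add_mem mult_mem diff_mem divide_mem uminus_mem of_nat_mem one_mem numeral_mem sqrt)+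

  \<comment> \<open>\<open>genideal\<close> is the intersection of all ideals containing the
    generators, so membership is proved in an arbitrary such ideal.\<close>
  have mem_ideal: "?f - (\<Sum>g \<in> VG. (?s g)\<^sup>2) \<in> I"
    if I: "ideal I (mpoly_ring K ?V)" and gens: "?gens \<subseteq> I" for I
  proof -
    interpret boolean_ideal K ?V I
    proof (intro boolean_ideal.intro boolean_ideal_axioms.intro)
      show "finite ?V" by (intro finite_vizing_vars VG VH)
      show "(Var v)\<^sup>2 - Var v \<in> I" if "v \<in> ?V" for v
      proof (rule subsetD[OF gens])
        show "(Var v)\<^sup>2 - Var v \<in> ?gens"
          using that unfolding vizing_vars_def graph_gens_def product_gens_def by blast
      qed
    qed (rule real_subfield_axioms I)+

    define num where "num A g = card {h \<in> VH. XV g h \<in> A}" for A :: "('g, 'h) vizing_var set" and g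
    have val_x: "val A (\<Sum>h \<in> VH. Var (XV g h)) (real (num A g))"
      if A: "A \<subseteq> ?V" and g: "g \<in> VG" for A g
    proof -
      have "val A (\<Sum>h \<in> VH. Var (XV g h)) (\<Sum>h \<in> VH. of_bool (XV g h \<in> A))"
        by (intro val_sum val_Var A vizing_vars_mem g)
      also have "(\<Sum>h \<in> VH. of_bool (XV g h \<in> A)) = (\<Sum>h \<in> VH. of_bool (h \<in> {h \<in> VH. XV g h \<in> A}))"
        by (rule sum.cong) auto
      finally show ?thesis
        using VH by (subst (asm) sum_of_bool_mem) (auto simp: num_def)
    qed
    have val_s: "val A (?s g) (interpolant nH (num A g))" if A: "A \<subseteq> ?V" and g: "g \<in> VG" for A g
    proof -
      have "val A (\<Sum>S \<in> pairs VH. \<Prod>h \<in> S. Var (XV g h))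
          (\<Sum>S \<in> pairs VH. \<Prod>h \<in> S. of_bool (XV g h \<in> A))"
        by (intro val_sum val_prod val_Var A vizing_vars_mem g) (auto simp: pairs_def)
      also have "(\<Sum>S \<in> pairs VH. \<Prod>h \<in> S. of_bool (XV g h \<in> A))
          = (\<Sum>S \<in> pairs VH. \<Prod>h \<in> S. of_bool (h \<in> {h \<in> VH. XV g h \<in> A}))"
        by (intro sum.cong prod.cong) (auto simp: pairs_def)
      finally have "val A (\<Sum>S \<in> pairs VH. \<Prod>h \<in> S. Var (XV g h)) (real (num A g choose 2))"
        using VH by (subst (asm) sum_pairs_of_bool_mem) (auto simp: num_def)
      then show ?thesis
        unfolding sos_poly_def interpolant_def \<alpha> [symmetric] \<beta> [symmetric] \<gamma> [symmetric]
        by (intro val_add val_mult val_Const val_x A g coeffs)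
    qed
    have val_f: "val A (?f - (\<Sum>g \<in> VG. (?s g)\<^sup>2))
        ((\<Sum>g \<in> VG. real (num A g)) - real nG * real (nH - 2)
          - (\<Sum>g \<in> VG. (interpolant nH (num A g))\<^sup>2))" if "A \<subseteq> ?V" for A
      unfolding f_star_def
      by (intro val_diff val_sum val_power2 val_x val_s val_Const mult_mem of_nat_mem that)

    show ?thesis
    proof (rule mem_if_vanishes_on_zeros)
      show "?f - (\<Sum>g \<in> VG. (?s g)\<^sup>2) \<in> poly_carrier ?V"
        \<comment> \<open>Lying in the polynomial ring is part of \<open>val\<close>, so evaluation
          at any one point provides it; the empty set is a convenient choice.\<close>
        using val_f[of "{}"] by (simp add: val_def)
    next
      fix A assume A: "A \<subseteq> ?V" and zero: "\<And>q c. \<lbrakk>q \<in> I; val A q c\<rbrakk> \<Longrightarrow> c = 0"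
      have no_edge: "EG {g, g'} \<notin> A" if g: "g \<in> VG" "g' \<in> VG" "g \<noteq> g'" for g g'
      proof -
        \<comment> \<open>Because the domination parameter of G equals its order, this set has the
          size required in the third generator family, and the outer product has the single factor
          for \<open>g'\<close>. A vanishing sum of 0/1 values then rules out every edge at
          \<open>g'\<close>.\<close>
        let ?S = "VG - {g'}"
        have "card ?S = nG - 1"
          using g VG by simp
        then have "(\<Prod>v' \<in> VG - ?S. \<Sum>v \<in> ?S. Var (EG {v, v'})) \<in> ?gens"
          unfolding graph_gens_def by blast
        moreover have "val A (\<Prod>v' \<in> VG - ?S. \<Sum>v \<in> ?S. Var (EG {v, v'}))
            (\<Prod>v' \<in> VG - ?S. \<Sum>v \<in> ?S. of_bool (EG {v, v'} \<in> A))"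
          by (intro val_prod val_sum val_Var A vizing_vars_mem) auto
        ultimately have "(\<Prod>v' \<in> VG - ?S. \<Sum>v \<in> ?S. of_bool (EG {v, v'} \<in> A) :: real) = 0"
          by (rule zero[OF subsetD[OF gens]])
        then obtain w where "w \<in> VG - ?S" "(\<Sum>v \<in> ?S. of_bool (EG {v, w} \<in> A) :: real) = 0"
          by (rule prod_eq_0_obtains)
        moreover have "w = g'"
          using calculation(1) by blast
        moreover have "finite ?S"
          using VG(1) by blast
        ultimately have "\<forall>v \<in> ?S. EG {v, g'} \<notin> A"
          by (auto simp: sum_nonneg_eq_0_iff)
        then show ?thesis
          using g by blast
      qed

      \<comment> \<open>Some factor of the third-family generator vanishes, and a vanishing sum of
        0/1 values has only zero terms: this vertex has no neighbour in \<open>S\<close>.\<close>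
      have nondom: "\<exists>w \<in> VH - S. \<forall>v \<in> S. {v, w} \<notin> {e. EH e \<in> A}"
        if S: "S \<subseteq> VH" "card S = nH - 2 - 1" for S
      proof -
        have "(\<Prod>v' \<in> VH - S. \<Sum>v \<in> S. Var (EH {v, v'})) \<in> ?gens"
          unfolding graph_gens_def using S by blast
        moreover have "val A (\<Prod>v' \<in> VH - S. \<Sum>v \<in> S. Var (EH {v, v'}))
            (\<Prod>v' \<in> VH - S. \<Sum>v \<in> S. of_bool (EH {v, v'} \<in> A))"
          using S by (intro val_prod val_sum val_Var A vizing_vars_mem) auto
        ultimately have "(\<Prod>v' \<in> VH - S. \<Sum>v \<in> S. of_bool (EH {v, v'} \<in> A) :: real) = 0"
          by (rule zero[OF subsetD[OF gens]])
        then obtain w where w: "w \<in> VH - S" "(\<Sum>v \<in> S. of_bool (EH {v, w} \<in> A) :: real) = 0"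
          by (rule prod_eq_0_obtains)
        moreover have "finite S"
          using S VH by (auto intro: finite_subset)
        ultimately have "\<forall>v \<in> S. EH {v, w} \<notin> A"
          by (auto simp: sum_nonneg_eq_0_iff)
        then show ?thesis
          using w(1) by auto
      qed

      have dom: "\<exists>h' \<in> {h \<in> VH. XV g h \<in> A}. {h, h'} \<in> {e. EH e \<in> A}"
        if g: "g \<in> VG" and h: "h \<in> VH - {h \<in> VH. XV g h \<in> A}" for g h
      proof -
        let ?e = "\<lambda>v. of_bool (v \<in> A) :: real"
        have "(1 - Var (XV g h)) *
            (\<Prod>g' \<in> VG - {g}. 1 - Var (EG {g, g'}) * Var (XV g' h)) *
            (\<Prod>h' \<in> VH - {h}. 1 - Var (EH {h, h'}) * Var (XV g h')) \<in> ?gens"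
          unfolding product_gens_def using g h by blast
        moreover have "val A ((1 - Var (XV g h)) *
            (\<Prod>g' \<in> VG - {g}. 1 - Var (EG {g, g'}) * Var (XV g' h)) *
            (\<Prod>h' \<in> VH - {h}. 1 - Var (EH {h, h'}) * Var (XV g h')))
          ((1 - ?e (XV g h)) * (\<Prod>g' \<in> VG - {g}. 1 - ?e (EG {g, g'}) * ?e (XV g' h)) *
            (\<Prod>h' \<in> VH - {h}. 1 - ?e (EH {h, h'}) * ?e (XV g h')))"
          using g h by (intro val_mult val_prod val_diff val_1 val_Var A vizing_vars_mem) auto
        ultimately have "(1 - ?e (XV g h)) *
            (\<Prod>g' \<in> VG - {g}. 1 - ?e (EG {g, g'}) * ?e (XV g' h)) *
            (\<Prod>h' \<in> VH - {h}. 1 - ?e (EH {h, h'}) * ?e (XV g h')) = 0"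
          by (rule zero[OF subsetD[OF gens]])
        \<comment> \<open>Without edges in G nothing is dominated across fibres, so this product is
          1. The first factor is 1 too, as \<open>h\<close> is not chosen, hence the product over H
          vanishes and yields a chosen neighbour in the same fibre.\<close>
        moreover have "(\<Prod>g' \<in> VG - {g}. 1 - ?e (EG {g, g'}) * ?e (XV g' h)) = 1"
          using no_edge g by (intro prod.neutral) auto
        ultimately have "(\<Prod>h' \<in> VH - {h}. 1 - ?e (EH {h, h'}) * ?e (XV g h')) = 0"
          using h by auto
        then obtain h' where "h' \<in> VH - {h}" "1 - ?e (EH {h, h'}) * ?e (XV g h') = 0"
          by (rule prod_eq_0_obtains)
        then show ?thesis
          by (auto simp: of_bool_def split: if_splits)
      qed

      have "(interpolant nH (num A g))\<^sup>2 = real (num A g) - real (nH - 2)" if g: "g \<in> VG" for g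
      proof (rule interpolant_power2)
        show "nH - 2 \<le> num A g"
          unfolding num_def
        proof (rule card_fibre_ge)
          show "nH - 2 \<le> card VH" using VH(2) by simp
          show "{h \<in> VH. XV g h \<in> A} \<subseteq> VH" by blast
        qed (rule VH(1), erule (1) nondom, erule dom[OF g])
        show "num A g \<le> nH"
          unfolding num_def VH(2) [symmetric] by (rule card_mono[OF VH(1)]) blast
      qed (rule VH)
      \<comment> \<open>The squares add up to the sum of \<open>num A g\<close> minus
        \<open>nG\<close> copies of \<open>nH - 2\<close>, which is the value of
        \<open>f_star\<close>.\<close>
      then show "val A (?f - (\<Sum>g \<in> VG. (?s g)\<^sup>2)) 0"
        using val_f[OF A] VG by (simp add: sum_subtractf)
    qed
  qed

  have "?s g \<in> poly_carrier ?V" if "g \<in> VG" for g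
  proof -
    have "Var (XV g h) \<in> poly_carrier ?V" if "h \<in> VH" for h
      using that \<open>g \<in> VG\<close> by (intro Var_mem vizing_vars_mem)
    then show ?thesis
      unfolding sos_poly_def pairs_def
      by (intro poly_add_mem poly_mult_mem Const_mem poly_sum_mem poly_prod_mem coeffs) auto
  qed
  then show ?thesis
    unfolding sos_certificate_def I_sos_def genideal_def
    using mem_ideal VG(1) by (auto simp: total_degree_le_iff deg_le_sos_poly)
qed

end


section \<open>Domination numbers\<close>

lemma finite_dominating: "finite (pverts G) \<Longrightarrow> finite {D. dominating G D}"
  by (rule finite_subset[of _ "Pow (pverts G)"]) (auto simp: dominating_def)

lemma dominating_pverts: "dominating G (pverts G)"
  by (simp add: dominating_def)

lemma domination_number_le:
  "\<lbrakk>finite (pverts G); dominating G D\<rbrakk> \<Longrightarrow> domination_number G \<le> card D"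
  unfolding domination_number_def by (intro Min_le finite_imageI finite_dominating) auto

lemma domination_number_attained:
  assumes "finite (pverts G)"
  obtains D where "dominating G D" "card D = domination_number G"
proof -
  have "domination_number G \<in> card ` {D. dominating G D}"
    unfolding domination_number_def using assms dominating_pverts
    by (intro Min_in finite_imageI finite_dominating) auto
  then show ?thesis
    using that by auto
qed

text \<open>Given an edge, all vertices except one of its ends form a dominating set, since the
  other end dominates the missing vertex.\<close>

lemma edgeless_if_domination_number_eq_card:
  assumes "pair_graph G" "domination_number G = card (pverts G)"
  shows "parcs G = {}"
proof (rule ccontr)
  assume "parcs G \<noteq> {}"
  then obtain u v where uv: "(u, v) \<in> parcs G"
    by auto
  interpret pair_graph G by (rule assms(1))
  have mem: "u \<in> pverts G" "v \<in> pverts G" "u \<noteq> v"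
    using uv wellformed' no_loops' by auto
  then have "dominating G (pverts G - {u})"
    using uv by (auto simp: dominating_def)
  then have "domination_number G \<le> card (pverts G - {u})"
    by (rule domination_number_le[OF pair_finite_verts])
  also have "\<dots> < card (pverts G)"
    using mem by (intro card_Diff1_less pair_finite_verts)
  finally show False
    using assms(2) by simp
qed

text \<open>When G has no edges, the product is a disjoint union of copies of H, and a dominating
  set must dominate each copy from within.\<close>

lemma vizing_edgeless:
  assumes G: "finite (pverts G)" "parcs G = {}" and H: "finite (pverts H)"
  shows "card (pverts G) * domination_number H \<le> domination_number (G \<box> H)"
proof -
  have verts: "pverts (G \<box> H) = pverts G \<times> pverts H"
    by (simp add: cartesian_product_def)
  then obtain D where D: "dominating (G \<box> H) D" "card D = domination_number (G \<box> H)"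
    using domination_number_attained[of "G \<box> H"] G H by auto
  define fibre where "fibre g = {h. (g, h) \<in> D}" for g
  have fibre: "dominating H (fibre g)" if "g \<in> pverts G" for g
    using D(1) that G(2) unfolding dominating_def fibre_def
    by (fastforce simp: cartesian_product_def)
  \<comment> \<open>Written as a disjoint union of fibres, \<open>D\<close> has cardinality equal to
    the sum of the fibre sizes.\<close>
  have D_eq: "D = Sigma (pverts G) fibre"
    using D(1) by (auto simp: dominating_def fibre_def verts)
  have "card (pverts G) * domination_number H = (\<Sum>g \<in> pverts G. domination_number H)"
    by simp
  also have "\<dots> \<le> (\<Sum>g \<in> pverts G. card (fibre g))"
    by (intro sum_mono domination_number_le H fibre)
  also have "\<dots> = card D"
    unfolding D_eq using fibre H G(1)
    by (subst card_SigmaI) (auto simp: dominating_def intro: finite_subset)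
  finally show ?thesis
    using D(2) by simp
qed

theorem theorem5p2:
  fixes nG kG nH kH :: nat
    and \<alpha> \<beta> \<gamma> :: real
  assumes "kG = nG" and "nG \<ge> 2"
    and "kH = nH - 2" and "nH - 2 \<ge> 2"
    and "\<alpha> = (real nH - 2) * (real nH + 1 / 2 * (real nH - 1) * sqrt 2)"
    and "\<beta> = - ((2 * real nH - 3) + (real nH - 2) * sqrt 2)"
    and "\<gamma> = 2 + sqrt 2"
  shows
    "(\<forall>(K :: real set) (VG :: 'g set) DG (VH :: 'h set) DH.
        subfield K ring_of_type_algebra \<and> sqrt 2 \<in> K \<and>
        finite VG \<and> card VG = nG \<and> DG \<subseteq> VG \<and> card DG = kG \<and>
        finite VH \<and> card VH = nH \<and> DH \<subseteq> VH \<and> card DH = kH \<longrightarrow>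
        sos_certificate K (vizing_vars VG VH) (I_sos K VG DG kG VH DH kH) 2 VG
          (\<lambda>g. Const \<alpha>
             + Const \<beta> * (\<Sum>h \<in> VH. Var (XV g h))
             + Const \<gamma> * (\<Sum>S \<in> pairs VH. \<Prod>h \<in> S. Var (XV g h)))
          (f_star VG kG VH kH))
     \<and>
     (\<forall>(G :: 'a pair_pre_digraph) (H :: 'b pair_pre_digraph).
        pair_graph G \<and> card (pverts G) = nG \<and> domination_number G = kG \<and>
        pair_graph H \<and> card (pverts H) = nH \<and> domination_number H = kH \<longrightarrow>
        domination_number G * domination_number H \<le> domination_number (G \<box> H))"
proof (intro conjI allI impI, goal_cases)
  case (1 K VG DG VH DH)
  then interpret real_subfield K
    by (simp add: real_subfield_def)
  show ?case
    using 1 assms sos_certificate_vizing[of VG nG VH nH \<alpha> \<beta> \<gamma> DG DH]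
    by (simp add: sos_poly_def [abs_def])
next
  case (2 G H)
  \<comment> \<open>Vizing's inequality is derived directly from the edgelessness of G, without
    passing through the certificate.\<close>
  then have "finite (pverts G)" "finite (pverts H)"
    by (auto simp: pair_graph_def pair_digraph_def intro: pair_fin_digraph.pair_finite_verts)
  moreover have "parcs G = {}"
    using 2 assms(1) by (intro edgeless_if_domination_number_eq_card) auto
  ultimately show ?case
    using vizing_edgeless[of G H] 2 assms(1) by simp
qed

end
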